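(* Let $D$ be a domain in $\mathbb{R}^n$, $n\geqslant 2$, let $p>n-1$, and suppose that $\partial D$ is strongly accessible at the point $x_0\in\partial D\setminus\{\infty\}$ with respect to $p$-modulus. Then $D$ is finitely connected at $x_0$; in other words, for any neighborhood $U$ of $x_0$ there exists a neighborhood $V\subset U$ of $x_0$ such that $V\cap D$ has a finite number of connected components.
   Context: Strong accessibility: $\partial D$ is strongly accessible at $x_0\in\partial D$ with respect to $p$-modulus if for any neighborhood $U$ of $x_0$ there are a compact set $E\subset D$, a neighborhood $V\subset U$ of $x_0$ and a number $\delta>0$ such that $M_p(\Gamma(E,F,D))\geqslant\delta$ for any continuum $F$ in $D$ with $F\cap\partial U\neq\varnothing\neq F\cap\partial V$. A continuum is a compact connected set, understood to be nondegenerate (containing more than one point). For sets $E_0,E_1\subset\overline{\mathbb{R}^n}=\mathbb{R}^n\cup\{\infty\}$ and a domain $D$, $\Gamma(E_0,E_1,D)$ denotes the family of all paths joining $E_0$ and $E_1$ in $D$, i.e. continuous $\gamma:[a,b]\to\overline{\mathbb{R}^n}$ with $\gamma(a)\in E_0$, $\gamma(b)\in E_1$ and $\gamma(t)\in D$ for $a<t<b$. A Borel function $\rho:\mathbb{R}^n\to[0,\infty]$ is admissible for a family $\Gamma$ of paths, written $\rho\in\mathrm{adm}\,\Gamma$, if $\int_\gamma\rho(x)\,|dx|\geqslant 1$ for every locally rectifiable path $\gamma\in\Gamma$. For $p\geqslant 1$ the $p$-modulus of $\Gamma$ is $M_p(\Gamma)=\inf_{\rho\in\mathrm{adm}\,\Gamma}\int_{\mathbb{R}^n}\rho^p(x)\,dm(x)$,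 where $m$ is Lebesgue measure. A family containing a constant path has infinite $p$-modulus (no admissible functions, $\inf\varnothing=\infty$). *)

theory Defs
  imports "HOL-Analysis.Analysis"
begin

definition domain :: "'a::euclidean_space set \<Rightarrow> bool" where
  "domain D \<longleftrightarrow> open D \<and> connected D \<and> D \<noteq> {}"

definition continuum :: "'a::topological_space set \<Rightarrow> bool" where
  "continuum F \<longleftrightarrow> compact F \<and> connected F \<and> (\<exists>x\<in>F. \<exists>y\<in>F. x \<noteq> y)"

text \<open>
  A path is a triple \<open>(a, b, \<gamma>)\<close> with \<open>a < b\<close>, of which only the restriction of \<open>\<gamma>\<close> to
  \<open>{a..b}\<close> matters.  All sets below lie in the finite space, so no path of the family
  can meet the point at infinity.
\<close>

definition joining_paths ::
  "'a::euclidean_space set \<Rightarrow> 'a set \<Rightarrow> 'a set \<Rightarrow> (real \<times> real \<times> (real \<Rightarrow> 'a)) set" where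
  "joining_paths E0 E1 D =
     {(a, b, \<gamma>). a < b \<and> continuous_on {a..b} \<gamma> \<and> \<gamma> a \<in> E0 \<and> \<gamma> b \<in> E1 \<and>
        (\<forall>t. a < t \<and> t < b \<longrightarrow> \<gamma> t \<in> D)}"

text \<open>Length of the subpath on \<open>{s..t}\<close>, where \<open>s \<le> t\<close>: supremum over all partitions.\<close>

definition curve_length :: "(real \<Rightarrow> 'a::metric_space) \<Rightarrow> real \<Rightarrow> real \<Rightarrow> ennreal" where
  "curve_length \<gamma> s t =
     Sup {ennreal (\<Sum>i<n. dist (\<gamma> (\<tau> i)) (\<gamma> (\<tau> (Suc i)))) | (n::nat) (\<tau> :: nat \<Rightarrow> real).
            \<tau> 0 = s \<and> \<tau> n = t \<and> (\<forall>i<n. \<tau> i \<le> \<tau> (Suc i))}"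

text \<open>Every closed subpath has finite length; for paths on \<open>{a..b}\<close> this includes the path itself.\<close>

definition locally_rectifiable :: "real \<times> real \<times> (real \<Rightarrow> 'a::metric_space) \<Rightarrow> bool" where
  "locally_rectifiable = (\<lambda>(a, b, \<gamma>).
     \<forall>s t. a \<le> s \<and> s \<le> t \<and> t \<le> b \<longrightarrow> curve_length \<gamma> s t < \<infinity>)"

text \<open>
  Arc-length parametrization.  The choice made by \<^const>\<open>inv_into\<close> is immaterial, since a
  rectifiable path is constant on any interval on which its length function is constant.
\<close>

definition arclength_param :: "real \<Rightarrow> real \<Rightarrow> (real \<Rightarrow> 'a::metric_space) \<Rightarrow> real \<Rightarrow> 'a" where
  "arclength_param a b \<gamma> s = \<gamma> (inv_into {a..b} (\<lambda>t. enn2real (curve_length \<gamma> a t)) s)"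

text \<open>Integral of \<open>\<rho>\<close> with respect to arc length; meaningful for rectifiable paths.\<close>

definition path_integral ::
  "('a::euclidean_space \<Rightarrow> ennreal) \<Rightarrow> real \<times> real \<times> (real \<Rightarrow> 'a) \<Rightarrow> ennreal" where
  "path_integral \<rho> = (\<lambda>(a, b, \<gamma>).
     \<integral>\<^sup>+ s \<in> {0..enn2real (curve_length \<gamma> a b)}. \<rho> (arclength_param a b \<gamma> s) \<partial>lborel)"

definition admissible ::
  "(real \<times> real \<times> (real \<Rightarrow> 'a::euclidean_space)) set \<Rightarrow> ('a \<Rightarrow> ennreal) set" where
  "admissible \<Gamma> = {\<rho>. \<rho> \<in> borel_measurable borel \<and>
     (\<forall>g\<in>\<Gamma>. locally_rectifiable g \<longrightarrow> 1 \<le> path_integral \<rho> g)}"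

text \<open>Real powers on \<open>[0, \<infinity>]\<close>, intended for exponents \<open>p > 0\<close>.\<close>

definition ennpow :: "ennreal \<Rightarrow> real \<Rightarrow> ennreal" where
  "ennpow x p = (if x = \<infinity> then \<infinity> else ennreal (enn2real x powr p))"

definition modulus ::
  "real \<Rightarrow> (real \<times> real \<times> (real \<Rightarrow> 'a::euclidean_space)) set \<Rightarrow> ennreal" where
  "modulus p \<Gamma> = (INF \<rho>\<in>admissible \<Gamma>. \<integral>\<^sup>+ x. ennpow (\<rho> x) p \<partial>lborel)"

text \<open>Neighborhoods of a point are open sets containing it.\<close>

definition strongly_accessible_at ::
  "real \<Rightarrow> 'a::euclidean_space set \<Rightarrow> 'a \<Rightarrow> bool" where
  "strongly_accessible_at p D x0 \<longleftrightarrow>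
     (\<forall>U. open U \<and> x0 \<in> U \<longrightarrow>
        (\<exists>E V \<delta>. compact E \<and> E \<subseteq> D \<and> open V \<and> x0 \<in> V \<and> V \<subseteq> U \<and> (0::real) < \<delta> \<and>
           (\<forall>F. continuum F \<and> F \<subseteq> D \<and> F \<inter> frontier U \<noteq> {} \<and> F \<inter> frontier V \<noteq> {} \<longrightarrow>
              ennreal \<delta> \<le> modulus p (joining_paths E F D))))"

definition finitely_connected_at :: "'a::euclidean_space set \<Rightarrow> 'a \<Rightarrow> bool" where
  "finitely_connected_at D x0 \<longleftrightarrow>
     (\<forall>U. open U \<and> x0 \<in> U \<longrightarrow>
        (\<exists>V. open V \<and> x0 \<in> V \<and> V \<subseteq> U \<and> finite (components (V \<inter> D))))"

end

theory Submission
  imports Defs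
begin

text \<open>
  Let \<open>B(s)\<close> be the ball of radius \<open>s\<close> about \<open>x\<^sub>0\<close>, and suppose infinitely many components \<open>K\<close> of
  \<open>D \<inter> B(r)\<close> come close to \<open>x\<^sub>0\<close>.  Each contains a continuum \<open>F\<close> crossing from near \<open>x\<^sub>0\<close> to the
  sphere of radius \<open>r/3\<close>, and all but finitely many are disjoint from the compact set \<open>E \<inter> B(r/2)\<close>.
  A path in \<open>D\<close> from \<open>E\<close> to such an \<open>F\<close> must then cross the shell between the radii \<open>r/2\<close> and \<open>r/3\<close>
  inside \<open>K\<close>, so \<open>6/r\<close> times the indicator of \<open>K \<inter> B(r/2)\<close> is admissible and the modulus is at most
  \<open>(6/r)\<^sup>p\<close> times the volume of \<open>K \<inter> B(r/2)\<close>.  These volumes are those of disjoint subsets of a ball,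
  so they cannot all stay above a positive constant.
\<close>

section \<open>Arc length\<close>

lemma curve_length_ge_sum:
  assumes "\<tau> 0 = s" "\<tau> n = t" "\<And>i. i < n \<Longrightarrow> \<tau> i \<le> \<tau> (Suc i)"
  shows "ennreal (\<Sum>i<n. dist (\<gamma> (\<tau> i)) (\<gamma> (\<tau> (Suc i)))) \<le> curve_length \<gamma> s t"
  unfolding curve_length_def using assms by (intro Sup_upper) blast

lemma curve_length_ge_dist:
  assumes "s \<le> t"
  shows "ennreal (dist (\<gamma> s) (\<gamma> t)) \<le> curve_length \<gamma> s t"
  using curve_length_ge_sum[of "\<lambda>i. if i = 0 then s else t" s 1 t \<gamma>] assms by simp

text \<open>A partition of the left interval followed by one of the right interval is a partition of
  the whole; suprema are then taken in each summand separately.\<close>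

lemma curve_length_superadditive:
  assumes "s \<le> t" "t \<le> u"
  shows "curve_length \<gamma> s t + curve_length \<gamma> t u \<le> curve_length \<gamma> s u"
proof -
  let ?S = "\<lambda>n \<tau>. \<Sum>i<n. dist (\<gamma> (\<tau> i)) (\<gamma> (\<tau> (Suc i)))"
  let ?P = "\<lambda>s t. {ennreal (?S n \<tau>) | (n::nat) (\<tau> :: nat \<Rightarrow> real).
        \<tau> 0 = s \<and> \<tau> n = t \<and> (\<forall>i<n. \<tau> i \<le> \<tau> (Suc i))}"
  have join: "ennreal (?S n \<tau>) + ennreal (?S m \<sigma>) \<le> curve_length \<gamma> s u"
    if \<tau>: "\<tau> 0 = s" "\<tau> n = t" "\<forall>i<n. \<tau> i \<le> \<tau> (Suc i)"
      and \<sigma>: "\<sigma> 0 = t" "\<sigma> m = u" "\<forall>i<m. \<sigma> i \<le> \<sigma> (Suc i)" for n m and \<tau> \<sigma> :: "nat \<Rightarrow> real"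
  proof -
    \<comment> \<open>The two partitions share the node \<open>t\<close>: index \<open>n\<close>
      falls into the first branch, and \<open>\<tau> n = \<sigma> 0\<close> makes
      \<open>\<eta> (n + i) = \<sigma> i\<close> hold at \<open>i = 0\<close> as well.\<close>
    define \<eta> where "\<eta> i = (if i \<le> n then \<tau> i else \<sigma> (i - n))" for i
    have \<eta>_add: "\<eta> (n + i) = \<sigma> i" for i
      using \<tau> \<sigma> by (cases i) (auto simp: \<eta>_def)
    have "?S (n + m) \<eta> = ?S n \<eta> + (\<Sum>i<m. dist (\<gamma> (\<eta> (n + i))) (\<gamma> (\<eta> (n + Suc i))))"
      by (induction m) (auto simp: add.assoc)
    also have "?S n \<eta> = ?S n \<tau>"
      by (intro sum.cong) (auto simp: \<eta>_def)
    finally have *: "?S (n + m) \<eta> = ?S n \<tau> + ?S m \<sigma>"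
      by (simp only: \<eta>_add)
    have "\<eta> i \<le> \<eta> (Suc i)" if "i < n + m" for i
    proof (cases "i < n")
      case True
      then show ?thesis using \<tau> by (auto simp: \<eta>_def)
    next
      case False
      then have "i = n + (i - n)" "Suc i = n + Suc (i - n)" "i - n < m" using that by auto
      then show ?thesis using \<sigma> \<eta>_add by metis
    qed
    moreover have "\<eta> 0 = s" "\<eta> (n + m) = u"
      using \<tau> \<sigma> \<eta>_add[of m] by (auto simp: \<eta>_def)
    ultimately have "ennreal (?S (n + m) \<eta>) \<le> curve_length \<gamma> s u"
      by (intro curve_length_ge_sum) auto
    then show ?thesis
      unfolding * by (simp add: ennreal_plus sum_nonneg)
  qed
  \<comment> \<open>A constant summand moves inside a supremum only over a nonempty set; the
    one-edge partition is a member.\<close>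
  have ne: "?P s t \<noteq> {}" if "s \<le> t" for s t
  proof -
    have "ennreal (?S 1 (\<lambda>i. if i = 0 then s else t)) \<in> ?P s t"
      using that by (intro CollectI exI[of _ "1::nat"] exI[of _ "\<lambda>i. if i = 0 then s else t"]) auto
    then show ?thesis by blast
  qed
  have "curve_length \<gamma> s t + curve_length \<gamma> t u = (SUP x\<in>?P s t. x + curve_length \<gamma> t u)"
    unfolding curve_length_def[of \<gamma> s t]
    using ennreal_SUP_add_left[where f = "\<lambda>x. x", OF ne[OF assms(1)]] by simp
  also have "\<dots> \<le> curve_length \<gamma> s u"
  proof (rule SUP_least)
    fix x assume x: "x \<in> ?P s t"
    have "x + curve_length \<gamma> t u = (SUP y\<in>?P t u. x + y)"
      unfolding curve_length_def[of \<gamma> t u]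
      using ennreal_SUP_add_right[where f = "\<lambda>x. x", OF ne[OF assms(2)]] by simp
    also have "\<dots> \<le> curve_length \<gamma> s u"
    proof (rule SUP_least)
      fix y assume "y \<in> ?P t u"
      with x show "x + y \<le> curve_length \<gamma> s u" using join by blast
    qed
    finally show "x + curve_length \<gamma> t u \<le> curve_length \<gamma> s u" .
  qed
  finally show ?thesis .
qed

lemma curve_length_add_enn2real:
  assumes "s \<le> t" "t \<le> u" "curve_length \<gamma> s u < \<infinity>"
  shows "enn2real (curve_length \<gamma> s t) + enn2real (curve_length \<gamma> t u) \<le> enn2real (curve_length \<gamma> s u)"
proof -
  note * = curve_length_superadditive[OF assms(1,2), of \<gamma>]
  \<comment> \<open>\<open>enn2real\<close> sends \<infinity> to 0, so finiteness is what makes it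
    additive and monotone here.\<close>
  have fin: "curve_length \<gamma> s t + curve_length \<gamma> t u < top"
    using le_less_trans[OF * assms(3)] by simp
  then have "enn2real (curve_length \<gamma> s t) + enn2real (curve_length \<gamma> t u)
      = enn2real (curve_length \<gamma> s t + curve_length \<gamma> t u)"
    by (simp add: enn2real_plus)
  also have "\<dots> \<le> enn2real (curve_length \<gamma> s u)"
    using * assms(3) by (intro enn2real_mono) auto
  finally show ?thesis .
qed

text \<open>This treats a single edge of a partition: raising the truncation level from
  \<open>u\<close> to \<open>v\<close> adds at most the edge clamped to \<open>{u..v}\<close>. Only
  an edge straddling \<open>u\<close> needs the triangle inequality, through
  \<open>\<gamma> u\<close>.\<close>

lemma dist_truncated_le:
  fixes u v x y :: real
  assumes "u \<le> v" "x \<le> y"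
  shows "dist (\<gamma> (min x v)) (\<gamma> (min y v)) - dist (\<gamma> (min x u)) (\<gamma> (min y u))
      \<le> dist (\<gamma> (max u (min x v))) (\<gamma> (max u (min y v)))"
proof -
  consider "y \<le> u" | "x \<le> u" "u \<le> y" | "u \<le> x" using assms by linarith
  then show ?thesis
  proof cases
    case 2
    then have "min x v = x" "min x u = x" "min y u = u" "max u (min x v) = u"
      "max u (min y v) = min y v" using assms by auto
    then show ?thesis
      using dist_triangle[of "\<gamma> x" "\<gamma> (min y v)" "\<gamma> u"] by simp
  qed (use assms in \<open>auto simp: min_def max_def\<close>)
qed

text \<open>
  Truncating a partition at \<open>u\<close> gives a continuous function of \<open>u\<close>, and its deficit from the arc
  length is monotone in \<open>u\<close>.  So the deficit at the right end controls it uniformly.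
\<close>

lemma continuous_on_curve_length:
  assumes cont: "continuous_on {a..b} \<gamma>" and fin: "curve_length \<gamma> a b < \<infinity>" and "a \<le> b"
  shows "continuous_on {a..b} (\<lambda>u. enn2real (curve_length \<gamma> a u))"
proof -
  let ?l = "\<lambda>u. enn2real (curve_length \<gamma> a u)"
  have fin': "curve_length \<gamma> a u < \<infinity>" "curve_length \<gamma> u b < \<infinity>" if "u \<in> {a..b}" for u
  proof -
    have "curve_length \<gamma> a u + curve_length \<gamma> u b < top"
      using le_less_trans[OF curve_length_superadditive fin, of u] that by simp
    then show "curve_length \<gamma> a u < \<infinity>" "curve_length \<gamma> u b < \<infinity>" by auto
  qed
  have approx: "\<exists>f. continuous_on {a..b} f \<and> (\<forall>u\<in>{a..b}. dist (f u) (?l u) < e)" if "e > 0" for e :: real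
  proof -
    have "\<exists>n \<tau>. (\<tau> 0 = a \<and> \<tau> n = b \<and> (\<forall>i<n. \<tau> i \<le> \<tau> (Suc i))) \<and>
        ?l b - e < (\<Sum>i<n. dist (\<gamma> (\<tau> i)) (\<gamma> (\<tau> (Suc i))))"
    proof (rule ccontr)
      assume no_partition: "\<not> ?thesis"
      have *: "(\<Sum>i<n. dist (\<gamma> (\<tau> i)) (\<gamma> (\<tau> (Suc i)))) \<le> ?l b - e"
        if "\<tau> 0 = a" "\<tau> n = b" "\<forall>i<n. \<tau> i \<le> \<tau> (Suc i)" for n and \<tau> :: "nat \<Rightarrow> real"
        using no_partition that by (intro leI) blast
      have bound: "curve_length \<gamma> a b \<le> ennreal L" if L: "L = ?l b - e" for L
        unfolding curve_length_def[of \<gamma> a b]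
      proof (rule Sup_least)
        fix x assume "x \<in> {ennreal (\<Sum>i<n. dist (\<gamma> (\<tau> i)) (\<gamma> (\<tau> (Suc i)))) | (n::nat) (\<tau> :: nat \<Rightarrow> real).
            \<tau> 0 = a \<and> \<tau> n = b \<and> (\<forall>i<n. \<tau> i \<le> \<tau> (Suc i))}"
        then show "x \<le> ennreal L" using * unfolding L by (blast intro: ennreal_leI)
      qed
      have "?l b \<le> enn2real (ennreal (?l b - e))"
        by (rule enn2real_mono[OF bound[OF refl]]) simp
      \<comment> \<open>\<open>ennreal\<close> cuts negative numbers off at 0, so the bound
        contradicts \<open>e > 0\<close> only once \<open>?l b - e\<close> is known to be
        nonnegative; the one-edge partition shows this.\<close>
      moreover have "dist (\<gamma> a) (\<gamma> b) \<le> ?l b - e"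
        using *[of "\<lambda>i. if i = 0 then a else b" 1] \<open>a \<le> b\<close> by simp
      then have "0 \<le> ?l b - e"
        by (rule order.trans[OF zero_le_dist])
      ultimately show False using \<open>e > 0\<close> by simp
    qed
    then obtain n \<tau> where \<tau>: "\<tau> 0 = a" "\<tau> n = b" "\<forall>i<n. \<tau> i \<le> \<tau> (Suc i)"
      and close: "?l b - e < (\<Sum>i<n. dist (\<gamma> (\<tau> i)) (\<gamma> (\<tau> (Suc i))))" by auto
    define f where "f u = (\<Sum>i<n. dist (\<gamma> (min (\<tau> i) u)) (\<gamma> (min (\<tau> (Suc i)) u)))" for u
    have ge: "i \<le> n \<longrightarrow> a \<le> \<tau> i" for i
      by (induction i) (use \<tau> in \<open>auto simp: Suc_le_eq intro: order.trans\<close>)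
    have le: "\<tau> i \<le> b" if "i \<le> n" for i
      using that
    proof (induction i rule: inc_induct)
      case (step i)
      then show ?case using \<tau> by (meson order.trans)
    qed (use \<tau> in simp)
    have "continuous_on {a..b} (\<lambda>u. \<gamma> (min (\<tau> i) u))" if "i \<le> n" for i
    proof (rule continuous_on_compose2[OF cont])
      show "continuous_on {a..b} (\<lambda>u. min (\<tau> i) u)" by (intro continuous_intros)
    qed (use ge[of i] that in auto)
    then have contf: "continuous_on {a..b} f"
      unfolding f_def by (intro continuous_intros) auto
    have f_b: "f b = (\<Sum>i<n. dist (\<gamma> (\<tau> i)) (\<gamma> (\<tau> (Suc i))))"
      unfolding f_def by (intro sum.cong) (auto simp: le min_absorb1)
    have f_u: "f u \<le> ?l u" if u: "u \<in> {a..b}" for u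
    proof -
      have "ennreal (f u) \<le> curve_length \<gamma> a u"
        unfolding f_def by (intro curve_length_ge_sum) (use \<tau> u in \<open>auto simp: min_def\<close>)
      then have "enn2real (ennreal (f u)) \<le> ?l u"
        using fin'[OF u] by (intro enn2real_mono) auto
      then show ?thesis by (simp add: f_def sum_nonneg)
    qed
    have f_diff: "f b - f u \<le> ?l b - ?l u" if u: "u \<in> {a..b}" for u
    proof -
      \<comment> \<open>Clamping every node to \<open>{u..b}\<close> turns the partition of
        \<open>{a..b}\<close> into one of \<open>{u..b}\<close>.\<close>
      let ?g = "\<Sum>i<n. dist (\<gamma> (max u (min (\<tau> i) b))) (\<gamma> (max u (min (\<tau> (Suc i)) b)))"
      have "f b - f u \<le> ?g"
        unfolding f_def sum_subtractf[symmetric]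
        by (intro sum_mono dist_truncated_le) (use \<tau> u in auto)
      also have "ennreal ?g \<le> curve_length \<gamma> u b"
        by (rule curve_length_ge_sum[of "\<lambda>i. max u (min (\<tau> i) b)"])
          (use \<tau> u in \<open>auto simp: min_def max_def\<close>)
      then have "enn2real (ennreal ?g) \<le> enn2real (curve_length \<gamma> u b)"
        using fin'[OF u] by (intro enn2real_mono) auto
      then have "?g \<le> enn2real (curve_length \<gamma> u b)" by (simp add: sum_nonneg)
      also have "\<dots> \<le> ?l b - ?l u"
        using curve_length_add_enn2real[of a u b \<gamma>] u fin by simp
      finally show ?thesis .
    qed
    have "dist (f u) (?l u) < e" if u: "u \<in> {a..b}" for u
      using f_u[OF u] f_diff[OF u] close f_b by (auto simp: dist_real_def)
    with contf show ?thesis by blast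
  qed
  then have "\<forall>k. \<exists>f. continuous_on {a..b} f \<and> (\<forall>u\<in>{a..b}. dist (f u) (?l u) < inverse (real (Suc k)))"
    by simp
  then obtain f where f: "\<And>k. continuous_on {a..b} (f k)"
    "\<And>k u. u \<in> {a..b} \<Longrightarrow> dist (f k u) (?l u) < inverse (real (Suc k))"
    by metis
  have "uniform_limit {a..b} f ?l sequentially"
  proof (rule uniform_limitI)
    fix e :: real assume "e > 0"
    have "\<forall>\<^sub>F k in sequentially. inverse (real (Suc k)) < e"
      using order_tendstoD(2)[OF LIMSEQ_inverse_real_of_nat \<open>e > 0\<close>] by simp
    then show "\<forall>\<^sub>F k in sequentially. \<forall>u\<in>{a..b}. dist (f k u) (?l u) < e"
      by eventually_elim (use f(2) in \<open>meson order.strict_trans\<close>)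
  qed
  then show ?thesis
    by (rule uniform_limit_theorem[rotated]) (use f in auto)
qed

text \<open>
  By continuity of the arc length, \<^const>\<open>inv_into\<close> in \<^const>\<open>arclength_param\<close> is evaluated inside
  the range only.
\<close>

lemma path_integral_indicator_ge:
  fixes \<gamma> :: "real \<Rightarrow> 'a::euclidean_space"
  assumes cont: "continuous_on {a..b} \<gamma>" and rect: "locally_rectifiable (a, b, \<gamma>)"
    and s: "a \<le> s" "s \<le> b" and A: "\<And>u. s < u \<Longrightarrow> u \<le> b \<Longrightarrow> \<gamma> u \<in> A"
  shows "c * ennreal (dist (\<gamma> s) (\<gamma> b)) \<le> path_integral (\<lambda>x. c * indicator A x) (a, b, \<gamma>)"
proof -
  let ?l = "\<lambda>u. enn2real (curve_length \<gamma> a u)"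
  have fin: "curve_length \<gamma> u v < \<infinity>" if "a \<le> u" "u \<le> v" "v \<le> b" for u v
    using rect that by (auto simp: locally_rectifiable_def)
  have cl: "continuous_on {a..b} ?l"
    using cont fin[of a b] s by (intro continuous_on_curve_length) auto
  have add: "?l u + enn2real (curve_length \<gamma> u v) \<le> ?l v" if "a \<le> u" "u \<le> v" "v \<le> b" for u v
    using that fin[of a v] by (intro curve_length_add_enn2real) auto
  have mono: "?l u \<le> ?l v" if "a \<le> u" "u \<le> v" "v \<le> b" for u v
    using add[OF that] enn2real_nonneg[of "curve_length \<gamma> u v"] by linarith
  have "enn2real (ennreal (dist (\<gamma> s) (\<gamma> b))) \<le> enn2real (curve_length \<gamma> s b)"
    using fin[of s b] s curve_length_ge_dist[of s b \<gamma>] by (intro enn2real_mono) auto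
  then have dist_le: "dist (\<gamma> s) (\<gamma> b) \<le> ?l b - ?l s"
    using add[of s b] s by simp
  have in_A: "arclength_param a b \<gamma> \<sigma> \<in> A" if \<sigma>: "?l s < \<sigma>" "\<sigma> \<le> ?l b" for \<sigma>
  proof -
    define u where "u = inv_into {a..b} ?l \<sigma>"
    have "\<exists>x\<ge>s. x \<le> b \<and> ?l x = \<sigma>"
      using \<sigma> s by (intro IVT') (auto intro: continuous_on_subset[OF cl])
    then have "\<sigma> \<in> ?l ` {a..b}" using s by force
    then have "u \<in> {a..b}" "?l u = \<sigma>"
      unfolding u_def by (rule inv_into_into, rule f_inv_into_f)
    \<comment> \<open>If \<open>u \<le> s\<close>, monotonicity would give
      \<open>?l u \<le> ?l s < \<sigma>\<close>.\<close>
    moreover from this have "s < u"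
      using mono[of u s] s \<sigma> by fastforce
    ultimately show ?thesis
      using A[of u] by (simp add: arclength_param_def u_def)
  qed
  have "c * ennreal (dist (\<gamma> s) (\<gamma> b)) \<le> c * ennreal (?l b - ?l s)"
    using dist_le by (intro mult_left_mono ennreal_leI) auto
  \<comment> \<open>The interval is open on the left because \<open>\<gamma> s\<close> itself may
    lie outside \<open>A\<close>; its measure is still \<open>?l b - ?l s\<close>.\<close>
  also have "\<dots> = (\<integral>\<^sup>+ \<sigma>. c * indicator {?l s<..?l b} \<sigma> \<partial>lborel)"
    using mono[of s b] s by (simp add: nn_integral_cmult_indicator)
  also have "\<dots> \<le> path_integral (\<lambda>x. c * indicator A x) (a, b, \<gamma>)"
    unfolding path_integral_def prod.case
    using in_A by (intro nn_integral_mono) (auto simp: indicator_def intro: order.trans[OF enn2real_nonneg less_imp_le])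
  finally show ?thesis .
qed

section \<open>Modulus of paths ending in a component\<close>

text \<open>Take for \<open>s\<close> the last time at which the path is at distance at least
  \<open>s1\<close> from \<open>x0\<close>. The tail after \<open>s\<close> is connected, stays in
  \<open>D\<close> and in the ball, and ends in \<open>K\<close>, so it cannot leave the component
  \<open>K\<close>.\<close>

lemma joining_path_tail_in_component:
  fixes D :: "'a::euclidean_space set"
  assumes K: "K \<in> components (D \<inter> ball x0 r)" and "s1 \<le> r" "s0 < s1"
    and E: "E \<subseteq> D" "E \<inter> cball x0 s1 \<inter> K = {}" and F: "F \<subseteq> K" "F \<subseteq> cball x0 s0"
    and path: "(a, b, \<gamma>) \<in> joining_paths E F D"
  obtains s where "a \<le> s" "s \<le> b" "s1 - s0 \<le> dist (\<gamma> s) (\<gamma> b)"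
    "\<And>u. s < u \<Longrightarrow> u \<le> b \<Longrightarrow> \<gamma> u \<in> K \<inter> ball x0 s1"
proof -
  have "a < b" and cont: "continuous_on {a..b} \<gamma>" and ends: "\<gamma> a \<in> E" "\<gamma> b \<in> F"
    and inner: "\<forall>t. a < t \<and> t < b \<longrightarrow> \<gamma> t \<in> D"
    using path by (auto simp: joining_paths_def)
  have KD: "K \<subseteq> D" using in_components_subset[OF K] by auto
  have in_D: "\<gamma> t \<in> D" if "a \<le> t" "t \<le> b" for t
    using that inner ends E F KD by (cases "t = a"; cases "t = b") auto
  have in_K: "\<gamma> ` I \<subseteq> K" if "is_interval I" "I \<subseteq> {a..b}" "b \<in> I" "\<And>u. u \<in> I \<Longrightarrow> \<gamma> u \<in> ball x0 s1" for I
  proof (rule components_maximal[OF K])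
    show "connected (\<gamma> ` I)"
      using that cont by (intro connected_continuous_image)
        (auto intro: continuous_on_subset simp: is_interval_connected_1)
    show "\<gamma> ` I \<subseteq> D \<inter> ball x0 r"
      using that(2,4) in_D \<open>s1 \<le> r\<close> by fastforce
    show "K \<inter> \<gamma> ` I \<noteq> {}" using that(3) ends F by blast
  qed
  define T where "T = {u \<in> {a..b}. s1 \<le> dist x0 (\<gamma> u)}"
  have "compact T"
  proof -
    have "closed T" unfolding T_def
      by (intro continuous_on_closed_Collect_le continuous_intros cont closed_atLeastAtMost)
    moreover have "bounded T" by (rule bounded_subset[of "{a..b}"]) (auto simp: T_def)
    ultimately show ?thesis by (simp add: compact_eq_bounded_closed)
  qed
  \<comment> \<open>A path that never left the ball would lie wholly in \<open>K\<close>, and its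
    starting point would be a point of \<open>E\<close> in \<open>K\<close> excluded by
    \<open>E\<close>'s disjointness.\<close>
  have "T \<noteq> {}"
  proof
    assume "T = {}"
    then have "\<gamma> u \<in> ball x0 s1" if "u \<in> {a..b}" for u
      using that unfolding T_def by (metis (mono_tags, lifting) empty_Collect_eq mem_ball not_le)
    then have "\<gamma> a \<in> K" "\<gamma> a \<in> cball x0 s1"
      using in_K[of "{a..b}"] \<open>a < b\<close> by (auto simp: is_interval_cc less_imp_le)
    then show False using ends E by blast
  qed
  then obtain s where s: "s \<in> T" "\<forall>t\<in>T. t \<le> s"
    using compact_attains_sup[OF \<open>compact T\<close>] by blast
  have ball: "\<gamma> u \<in> ball x0 s1" if "s < u" "u \<le> b" for u
  proof (rule ccontr)
    assume "\<gamma> u \<notin> ball x0 s1"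
    then have "u \<in> T" using s(1) that by (auto simp: T_def)
    then show False using s(2) that by auto
  qed
  have b: "dist x0 (\<gamma> b) \<le> s0" using ends F by auto
  have "s \<noteq> b" using s b \<open>s0 < s1\<close> by (auto simp: T_def)
  then have "s < b" using s by (auto simp: T_def)
  show thesis
  proof
    show "a \<le> s" "s \<le> b" using s by (auto simp: T_def)
    show "s1 - s0 \<le> dist (\<gamma> s) (\<gamma> b)"
      using s b dist_triangle2[of x0 "\<gamma> s" "\<gamma> b"] by (auto simp: T_def dist_commute)
    show "\<gamma> u \<in> K \<inter> ball x0 s1" if "s < u" "u \<le> b" for u
    proof -
      have "{s<..b} \<subseteq> {a..b}" using s by (auto simp: T_def)
      then have "\<gamma> ` {s<..b} \<subseteq> K"
        using \<open>s < b\<close> ball by (intro in_K) (auto simp: is_interval_oc)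
      then show ?thesis using ball that by auto
    qed
  qed
qed

lemma modulus_joining_component_le:
  fixes D :: "'a::euclidean_space set"
  assumes "open D" and K: "K \<in> components (D \<inter> ball x0 r)" and "s1 \<le> r" "s0 < s1"
    and E: "E \<subseteq> D" "E \<inter> cball x0 s1 \<inter> K = {}" and F: "F \<subseteq> K" "F \<subseteq> cball x0 s0"
  shows "modulus p (joining_paths E F D)
    \<le> ennreal ((1 / (s1 - s0)) powr p) * emeasure lborel (K \<inter> ball x0 s1)"
proof -
  define c where "c = 1 / (s1 - s0)"
  \<comment> \<open>The height is the reciprocal of the shell width, so a tail whose ends are at
    least \<open>s1 - s0\<close> apart has \<open>\<rho>\<close>-length at least 1.\<close>
  define \<rho> where "\<rho> x = ennreal c * indicator (K \<inter> ball x0 s1) x" for x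
  have "open K" using open_components[OF _ K] \<open>open D\<close> by auto
  then have meas: "K \<inter> ball x0 s1 \<in> sets borel" by auto
  have "\<rho> \<in> admissible (joining_paths E F D)"
    unfolding admissible_def
  proof (intro CollectI conjI ballI impI)
    show "\<rho> \<in> borel_measurable borel"
      unfolding \<rho>_def using meas by measurable
    fix g assume g: "g \<in> joining_paths E F D" "locally_rectifiable g"
    obtain a b \<gamma> where [simp]: "g = (a, b, \<gamma>)" by (cases g)
    obtain s where s: "a \<le> s" "s \<le> b" "s1 - s0 \<le> dist (\<gamma> s) (\<gamma> b)"
      "\<And>u. s < u \<Longrightarrow> u \<le> b \<Longrightarrow> \<gamma> u \<in> K \<inter> ball x0 s1"
      using joining_path_tail_in_component[OF K assms(3-8) g(1)[simplified]] by metis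
    have "1 = ennreal c * ennreal (s1 - s0)"
      using \<open>s0 < s1\<close> by (simp add: c_def ennreal_mult[symmetric])
    also have "\<dots> \<le> ennreal c * ennreal (dist (\<gamma> s) (\<gamma> b))"
      using s by (intro mult_left_mono ennreal_leI) auto
    also have "\<dots> \<le> path_integral \<rho> g"
      unfolding \<rho>_def using g s
      by (auto simp: joining_paths_def intro!: path_integral_indicator_ge)
    finally show "1 \<le> path_integral \<rho> g" .
  qed
  then have "modulus p (joining_paths E F D) \<le> (\<integral>\<^sup>+ x. ennpow (\<rho> x) p \<partial>lborel)"
    unfolding modulus_def by (rule INF_lower)
  \<comment> \<open>Off the set the integrand vanishes because \<open>0 powr p = 0\<close>.\<close>
  also have "\<dots> = (\<integral>\<^sup>+ x. ennreal (c powr p) * indicator (K \<inter> ball x0 s1) x \<partial>lborel)"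
    using \<open>s0 < s1\<close> by (intro nn_integral_cong) (auto simp: ennpow_def \<rho>_def indicator_def c_def)
  also have "\<dots> = ennreal (c powr p) * emeasure lborel (K \<inter> ball x0 s1)"
    using meas by (simp add: nn_integral_cmult_indicator)
  finally show ?thesis by (simp add: c_def)
qed

section \<open>Components near a boundary point\<close>

text \<open>Otherwise the closure of \<open>K\<close> would stay inside the larger open ball, so
  \<open>K\<close> would be closed relative to \<open>D\<close> and not only to
  \<open>D \<inter> ball x0 r\<close>. Being open too, it would be all of the connected set
  \<open>D\<close>.\<close>

lemma component_not_subset_smaller_ball:
  fixes D :: "'a::euclidean_space set"
  assumes D: "open D" "connected D" and K: "K \<in> components (D \<inter> ball x0 r)"
    and "\<not> D \<subseteq> ball x0 r" "s < r"
  shows "\<not> K \<subseteq> ball x0 s"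
proof
  assume sub: "K \<subseteq> ball x0 s"
  have "open K" using open_components[OF _ K] D by auto
  have KD: "K \<subseteq> D" "K \<subseteq> ball x0 r" using in_components_subset[OF K] by auto
  have "closure K \<subseteq> cball x0 s"
    using sub ball_subset_cball by (intro closure_minimal) auto
  then have "closure K \<subseteq> ball x0 r" using \<open>s < r\<close> by force
  moreover have "(D \<inter> ball x0 r) \<inter> closure K = K"
    using closedin_component[OF K] by (simp add: closedin_Int_closure_of)
  ultimately have "K = D \<inter> closure K" using KD closure_subset by blast
  then have "closedin (top_of_set D) K" by (metis closedin_closed_Int closed_closure)
  moreover have "openin (top_of_set D) K"
    using \<open>open K\<close> KD by (simp add: open_openin_trans D)
  ultimately have "K = {} \<or> K = D" using D connected_clopen by blast
  then show False
    using in_components_nonempty[OF K] KD assms(4) by blast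
qed

text \<open>Join a point of \<open>K \<inter> V\<close> within \<open>K\<close> to a point outside
  the ball of radius \<open>s\<close>, and keep the piece up to the first hit of the sphere.\<close>

lemma component_contains_continuum:
  fixes D :: "'a::euclidean_space set"
  assumes "open D" and K: "K \<in> components (D \<inter> ball x0 r)" and "0 < s"
    and V: "open V" "V \<subseteq> ball x0 s" "K \<inter> V \<noteq> {}" and nsub: "\<not> K \<subseteq> ball x0 s"
  obtains F where "continuum F" "F \<subseteq> K" "F \<subseteq> cball x0 s"
    "F \<inter> frontier (ball x0 s) \<noteq> {}" "F \<inter> frontier V \<noteq> {}"
proof -
  have "open K" using open_components[OF _ K] \<open>open D\<close> by auto
  obtain z w where z: "z \<in> K" "z \<in> V" and w: "w \<in> K" "w \<notin> ball x0 s" using V nsub by blast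
  have "path_connected K"
    using \<open>open K\<close> in_components_connected[OF K] connected_open_path_connected by blast
  then obtain g where g: "path g" "path_image g \<subseteq> K" "pathstart g = z" "pathfinish g = w"
    using z w unfolding path_connected_def by blast
  obtain u where u: "0 \<le> u" "u \<le> 1" "g u \<in> frontier (ball x0 s)"
    "\<And>x. 0 \<le> x \<and> x < u \<Longrightarrow> g x \<in> interior (ball x0 s)"
  proof (rule subpath_to_frontier_explicit[OF g(1), of "ball x0 s"])
    show "pathfinish g \<notin> ball x0 s" using g w by simp
    fix u assume u: "0 \<le> u" "u \<le> 1" "\<And>x. 0 \<le> x \<and> x < u \<Longrightarrow> g x \<in> interior (ball x0 s)"
      "g u \<notin> interior (ball x0 s)" "u = 0 \<or> g u \<in> closure (ball x0 s)"
    have "g 0 \<in> ball x0 s" using g(3) z V(2) by (auto simp: pathstart_def)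
    then have "u \<noteq> 0" using u(4) by (auto simp: interior_open)
    then show thesis using u that by (auto simp: frontier_def)
  qed
  define F where "F = g ` {0..u}"
  have sphere: "frontier (ball x0 s) = sphere x0 s" using \<open>0 < s\<close> by simp
  have cg: "continuous_on {0..u} g"
    using g u by (auto simp: path_def intro: continuous_on_subset)
  have zF: "z \<in> F" using u g by (auto simp: F_def pathstart_def)
  have uF: "g u \<in> F" using u by (auto simp: F_def)
  \<comment> \<open>\<open>V\<close> lies in the open ball and \<open>g u\<close> on its sphere.
    This gives both nondegeneracy of \<open>F\<close> and, since \<open>F\<close> starts in
    \<open>V\<close>, a point of \<open>F\<close> on the frontier of \<open>V\<close>.\<close>
  have uV: "g u \<notin> V" using u(3) V(2) sphere by auto
  have conn: "connected F" unfolding F_def by (intro connected_continuous_image cg) auto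
  have "compact F" unfolding F_def by (intro compact_continuous_image cg) auto
  show thesis
  proof
    show "continuum F"
    proof -
      have "z \<noteq> g u" using uV z(2) by metis
      with zF uF have "\<exists>x\<in>F. \<exists>y\<in>F. x \<noteq> y" by (intro bexI)
      with \<open>compact F\<close> conn show ?thesis by (simp add: continuum_def)
    qed
    show "F \<subseteq> K" using g u by (auto simp: F_def path_image_def)
    show "F \<subseteq> cball x0 s"
    proof -
      have "g x \<in> cball x0 s" if "0 \<le> x" "x \<le> u" for x
        using u(3) u(4)[of x] that sphere by (cases "x = u") (auto simp: interior_open)
      then show ?thesis by (auto simp: F_def)
    qed
    show "F \<inter> frontier (ball x0 s) \<noteq> {}" using uF u by blast
    show "F \<inter> frontier V \<noteq> {}"
      using conn zF uF uV z by (intro connected_Int_frontier) auto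
  qed
qed

section \<open>Finiteness of families of components\<close>

text \<open>The components of an open set are an open cover by disjoint sets, so a finite subcover
  of \<open>C\<close> must contain each one that meets \<open>C\<close>.\<close>

lemma finite_components_meeting_compact:
  fixes S :: "'a::euclidean_space set"
  assumes "open S" "compact C" "C \<subseteq> S"
  shows "finite {K \<in> components S. K \<inter> C \<noteq> {}}"
proof -
  obtain \<C> where \<C>: "\<C> \<subseteq> components S" "finite \<C>" "C \<subseteq> \<Union>\<C>"
    using compactE[OF assms(2), of "components S"] assms open_components by (metis Union_components)
  have "{K \<in> components S. K \<inter> C \<noteq> {}} \<subseteq> \<C>"
    using \<C> components_nonoverlap by fastforce
  then show ?thesis using \<C>(2) finite_subset by blast
qed

text \<open>Any \<open>N\<close> members have disjoint traces on \<open>B\<close>, whence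
  \<open>N * \<epsilon> \<le> measure M B\<close>.\<close>

lemma finite_large_disjoint:
  assumes disj: "disjoint \<K>" and A: "\<And>K. K \<in> \<K> \<Longrightarrow> K \<inter> B \<in> sets M"
    and B: "B \<in> sets M" "emeasure M B < \<infinity>" and "0 < \<epsilon>"
    and large: "\<And>K. K \<in> \<K> \<Longrightarrow> ennreal \<epsilon> \<le> emeasure M (K \<inter> B)"
  shows "finite \<K>"
proof (rule ccontr)
  assume "infinite \<K>"
  obtain N :: nat where N: "measure M B / \<epsilon> < real N" using reals_Archimedean2 by blast
  obtain \<F> where \<F>: "\<F> \<subseteq> \<K>" "finite \<F>" "card \<F> = N"
    using infinite_arbitrarily_large[OF \<open>infinite \<K>\<close>] by blast
  have "ennreal (real N * \<epsilon>) = (\<Sum>K\<in>\<F>. ennreal \<epsilon>)"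
    using \<F> \<open>0 < \<epsilon>\<close> by (simp add: ennreal_mult ennreal_of_nat_eq_real_of_nat)
  also have "\<dots> \<le> (\<Sum>K\<in>\<F>. emeasure M (K \<inter> B))"
    using \<F>(1) by (intro sum_mono large) blast
  also have "\<dots> = emeasure M (\<Union>K\<in>\<F>. K \<inter> B)"
  proof (rule sum_emeasure)
    show "disjoint_family_on (\<lambda>K. K \<inter> B) \<F>"
      unfolding disjoint_family_on_def using disjointD[OF disj] \<F>(1) by blast
    show "(\<lambda>K. K \<inter> B) ` \<F> \<subseteq> sets M" using A \<F>(1) by blast
  qed (rule \<F>(2))
  also have "\<dots> \<le> emeasure M B" using B by (intro emeasure_mono) auto
  also have "\<dots> = ennreal (measure M B)" using B by (intro emeasure_eq_ennreal_measure) auto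
  finally have "real N * \<epsilon> \<le> measure M B" by (simp add: ennreal_le_iff)
  then show False using N \<open>0 < \<epsilon>\<close> by (simp add: field_simps)
qed

text \<open>Each component of the union contains every piece it meets, so it is determined by one
  such piece, through any chosen point of it.\<close>

lemma finite_components_Union_connected:
  assumes "finite \<K>" "\<And>K. K \<in> \<K> \<Longrightarrow> connected K"
  shows "finite (components (\<Union>\<K>))"
proof -
  have "components (\<Union>\<K>) \<subseteq> (\<lambda>K. connected_component_set (\<Union>\<K>) (SOME x. x \<in> K)) ` \<K>"
  proof
    fix C assume C: "C \<in> components (\<Union>\<K>)"
    then obtain x K where x: "x \<in> C" "K \<in> \<K>" "x \<in> K"
      using in_components_nonempty in_components_subset by blast
    have "K \<subseteq> C" by (rule components_maximal[OF C]) (use x assms in auto)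
    then have "(SOME x. x \<in> K) \<in> C" using x someI[of "\<lambda>x. x \<in> K"] by blast
    then have "C = connected_component_set (\<Union>\<K>) (SOME x. x \<in> K)"
      using C by (metis componentsE connected_component_eq)
    then show "C \<in> (\<lambda>K. connected_component_set (\<Union>\<K>) (SOME x. x \<in> K)) ` \<K>" using x by blast
  qed
  then show ?thesis using assms(1) finite_subset by blast
qed

section \<open>From strong accessibility to finite connectedness\<close>

lemma strongly_accessible_imp_finitely_connected:
  fixes D :: "'a::euclidean_space set"
  assumes D: "domain D" and acc: "strongly_accessible_at p D x0"
  shows "finitely_connected_at D x0"
  unfolding finitely_connected_at_def
proof (intro allI impI)
  fix U assume U: "open U \<and> x0 \<in> U"
  obtain r where r: "r > 0" "ball x0 r \<subseteq> U" using U openE by blast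
  have oD: "open D" and cD: "connected D" and "D \<noteq> {}" using D by (auto simp: domain_def)
  show "\<exists>V. open V \<and> x0 \<in> V \<and> V \<subseteq> U \<and> finite (components (V \<inter> D))"
  \<comment> \<open>Components are forced out towards the sphere of radius \<open>r\<close> only
    when \<open>D\<close> leaves the ball; otherwise the ball itself serves, as it cuts out the
    connected set \<open>D\<close>.\<close>
  proof (cases "D \<subseteq> ball x0 r")
    case True
    then have "ball x0 r \<inter> D = D" by blast
    then have "finite (components (ball x0 r \<inter> D))"
      using finite_components_Union_connected[of "{D}"] cD by simp
    then show ?thesis using r by (intro exI[of _ "ball x0 r"]) auto
  next
    case False
    define \<K> where "\<K> = components (D \<inter> ball x0 r)"
    obtain E V \<delta> where E: "compact E" "E \<subseteq> D"
      and V: "open V" "x0 \<in> V" "V \<subseteq> ball x0 (r/3)" and "0 < \<delta>"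
      and \<delta>: "\<And>F. continuum F \<and> F \<subseteq> D \<and> F \<inter> frontier (ball x0 (r/3)) \<noteq> {} \<and> F \<inter> frontier V \<noteq> {} \<Longrightarrow>
              ennreal \<delta> \<le> modulus p (joining_paths E F D)"
      \<comment> \<open>Accessibility is applied at radius \<open>r/3\<close>, which leaves the
        shell up to \<open>r/2\<close> for the length estimate and keeps the closed ball of radius
        \<open>r/2\<close> inside the ball of radius \<open>r\<close>.\<close>
      using acc[unfolded strongly_accessible_at_def, rule_format, of "ball x0 (r/3)"] r by auto
    define \<K>0 where "\<K>0 = {K \<in> \<K>. K \<inter> V \<noteq> {}}"
    define \<K>E where "\<K>E = {K \<in> \<K>. K \<inter> (E \<inter> cball x0 (r/2)) \<noteq> {}}"
    have open_K: "open K" if "K \<in> \<K>" for K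
      using that open_components[of "D \<inter> ball x0 r" K] oD by (auto simp: \<K>_def)
    have "finite \<K>E"
      unfolding \<K>E_def \<K>_def
      by (rule finite_components_meeting_compact) (use oD E r in \<open>auto intro: compact_Int\<close>)
    define c where "c = (1 / (r/2 - r/3)) powr p"
    have "c > 0" using r by (simp add: c_def)
    \<comment> \<open>For each such \<open>K\<close> the lower bound \<open>\<delta>\<close> and the
      upper bound \<open>c\<close> times the volume of \<open>K \<inter> ball x0 (r/2)\<close> force
      that volume to be at least \<open>\<delta> / c\<close>.\<close>
    have "finite (\<K>0 - \<K>E)"
    proof (rule finite_large_disjoint[where M = lborel and B = "ball x0 (r/2)" and \<epsilon> = "\<delta> / c"])
      show "disjoint (\<K>0 - \<K>E)"
        using pairwise_disjoint_components[of "D \<inter> ball x0 r"]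
        by (auto simp: \<K>0_def \<K>_def disjoint_def pairwise_def disjnt_def)
      show "emeasure lborel (ball x0 (r/2)) < \<infinity>"
        by (rule emeasure_lborel_ball_finite)
      show "0 < \<delta> / c" using \<open>0 < \<delta>\<close> \<open>c > 0\<close> by simp
      fix K assume K: "K \<in> \<K>0 - \<K>E"
      then have K': "K \<in> components (D \<inter> ball x0 r)" by (auto simp: \<K>0_def \<K>_def)
      show "K \<inter> ball x0 (r/2) \<in> sets lborel" using open_K K by (auto simp: \<K>0_def)
      have "\<not> K \<subseteq> ball x0 (r/3)"
        by (rule component_not_subset_smaller_ball[OF oD cD K' False]) (use r in auto)
      then obtain F where F: "continuum F" "F \<subseteq> K" "F \<subseteq> cball x0 (r/3)"
        "F \<inter> frontier (ball x0 (r/3)) \<noteq> {}" "F \<inter> frontier V \<noteq> {}"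
        using component_contains_continuum[OF oD K', of "r/3" V] r V K by (auto simp: \<K>0_def)
      have "F \<subseteq> D" using F in_components_subset[OF K'] by blast
      then have "ennreal \<delta> \<le> modulus p (joining_paths E F D)" using \<delta> F by blast
      also have "\<dots> \<le> ennreal c * emeasure lborel (K \<inter> ball x0 (r/2))"
        unfolding c_def
        by (rule modulus_joining_component_le[OF oD K'])
          (use r E F K in \<open>auto simp: \<K>E_def \<K>0_def\<close>)
      finally have le: "ennreal \<delta> \<le> ennreal c * emeasure lborel (K \<inter> ball x0 (r/2))" .
      have "ennreal (\<delta> / c) = ennreal (1 / c) * ennreal \<delta>"
        using \<open>0 < \<delta>\<close> \<open>c > 0\<close> by (simp add: ennreal_mult[symmetric])
      also have "\<dots> \<le> ennreal (1 / c) * (ennreal c * emeasure lborel (K \<inter> ball x0 (r/2)))"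
        by (rule mult_left_mono[OF le]) simp
      also have "\<dots> = emeasure lborel (K \<inter> ball x0 (r/2))"
        using \<open>c > 0\<close> by (simp add: mult.assoc[symmetric] ennreal_mult[symmetric])
      finally show "ennreal (\<delta> / c) \<le> emeasure lborel (K \<inter> ball x0 (r/2))" .
    qed simp
    then have fin: "finite \<K>0" using \<open>finite \<K>E\<close> by (metis finite_Diff2)
    \<comment> \<open>\<open>V \<inter> D\<close> itself may have infinitely many components. Adding
      to \<open>V\<close> every component in \<open>\<K>\<close> that it meets makes the
      intersection with \<open>D\<close> exactly the finite union
      \<open>\<Union>\<K>0\<close>.\<close>
    define W where "W = V \<union> \<Union>\<K>0"
    have KU: "\<Union>\<K> = D \<inter> ball x0 r" by (simp add: \<K>_def)
    have "V \<inter> D \<subseteq> \<Union>\<K>"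
      unfolding KU using V(3) r by force
    then have "W \<inter> D = \<Union>\<K>0"
      using Union_upper[of _ \<K>] KU unfolding W_def \<K>0_def by (blast dest: subsetD)
    moreover have "finite (components (\<Union>\<K>0))"
      using fin by (rule finite_components_Union_connected)
        (auto simp: \<K>0_def \<K>_def in_components_connected)
    moreover have "open W" using V open_K by (auto simp: W_def \<K>0_def)
    moreover have "W \<subseteq> U"
    proof -
      have "ball x0 (r/3) \<subseteq> ball x0 r" using r by (intro subset_ball) auto
      then show ?thesis using V KU r by (auto simp: W_def \<K>0_def)
    qed
    ultimately show ?thesis using V by (intro exI[of _ W]) (auto simp: W_def)
  qed
qed

theorem theorem1p3:
  fixes D :: "(real ^ 'n) set" and x0 :: "real ^ 'n" and p :: real
  assumes "CARD('n) \<ge> 2"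
    and "domain D"
    and "p > real CARD('n) - 1"
    and "x0 \<in> frontier D"
    and "strongly_accessible_at p D x0"
  shows "finitely_connected_at D x0"
  using assms(2,5) by (rule strongly_accessible_imp_finitely_connected)

end
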